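(* Let $g\in\mathcal{E}$ with $g\neq\mathrm{id}_{\omega}$, and let $R$ be a binary relation on a discrete space $A$. Then $R$ is a $g$-better-relation if and only if $R$ is a better-relation. In particular, a quasi-order $(Q,\leq)$ (with $Q$ discrete) is $g$-bqo if and only if it is a better-quasi-order.
   Context: $\mathcal{E}$ is the set of strictly increasing maps $\omega\to\omega$, with the topology induced by the Baire space $\omega^{\omega}$. $[\omega]^{\omega}$ is the set of infinite subsets of $\omega$ with the topology induced from the Cantor space $2^{\omega}$. For a binary relation $R$ on $A$, $R^{\complement}=(A\times A)\setminus R$. $R$ is a better-relation on the discrete space $A$ if there is no continuous map $\varphi:[\omega]^{\omega}\to A$ such that for every $N\in[\omega]^{\omega}$, $\varphi(N)\,R^{\complement}\,\varphi(N\setminus\{\min N\})$. $R$ is a $g$-better-relation if there is no continuous map $\varphi:\mathcal{E}\to A$ such that $\varphi(f)\,R^{\complement}\,\varphi(f\circ g)$ for every $f\in\mathcal{E}$ (equivalently, for every continuous $\varphi:\mathcal{E}\to A$ there is $h\in\mathcal{E}$ with $\varphi(h\circ f)\,R\,\varphi(h\circ f\circ g)$ for all $f\in\mathcal{E}$). A quasi-order is $g$-bqo if it is a $g$-better-relation, and a better-quasi-order (bqo) if it is a better-relation (equivalently, there is no locally constant $h:[\omega]^{\omega}\to Q$ with $h(N)\not\leq h(N\setminus\{\min N\})$ for all $N$). *)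

theory Defs
  imports "HOL-Analysis.Analysis"
begin

definition strict_increasing_maps :: "(nat \<Rightarrow> nat) set" where
  "strict_increasing_maps = {f. strict_mono f}"

definition increasing_topology :: "(nat \<Rightarrow> nat) topology" where
  "increasing_topology =
     subtopology (product_topology (\<lambda>_. discrete_topology UNIV) UNIV) strict_increasing_maps"

definition infinite_sets :: "nat set set" where
  "infinite_sets = {N. infinite N}"

text \<open>The Cantor space is \<^typ>\<open>nat \<Rightarrow> bool\<close> with the product topology; a set is
  identified with its characteristic function.\<close>

definition infinite_sets_topology :: "nat set topology" where
  "infinite_sets_topology =
     subtopology
       (pullback_topology UNIV (\<lambda>N n. n \<in> N)
          (product_topology (\<lambda>_. discrete_topology (UNIV :: bool set)) UNIV))
       infinite_sets"

text \<open>The least element is written with \<open>LEAST\<close> because \<^const>\<open>Min\<close> is unspecified on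
  infinite sets.\<close>

definition shift :: "nat set \<Rightarrow> nat set" where
  "shift N = N - {LEAST n. n \<in> N}"

definition rel_compl :: "'a set \<Rightarrow> 'a rel \<Rightarrow> 'a rel" where
  "rel_compl A R = (A \<times> A) - R"

text \<open>In the next two definitions, continuity into \<^term>\<open>discrete_topology A\<close> includes that
  \<open>\<phi>\<close> maps the whole domain space into \<open>A\<close>; values outside that space are irrelevant.\<close>

definition better_relation :: "'a set \<Rightarrow> 'a rel \<Rightarrow> bool" where
  "better_relation A R \<longleftrightarrow>
     \<not> (\<exists>\<phi>. continuous_map infinite_sets_topology (discrete_topology A) \<phi> \<and>
            (\<forall>N\<in>infinite_sets. (\<phi> N, \<phi> (shift N)) \<in> rel_compl A R))"

definition g_better_relation :: "(nat \<Rightarrow> nat) \<Rightarrow> 'a set \<Rightarrow> 'a rel \<Rightarrow> bool" where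
  "g_better_relation g A R \<longleftrightarrow>
     \<not> (\<exists>\<phi>. continuous_map increasing_topology (discrete_topology A) \<phi> \<and>
            (\<forall>f\<in>strict_increasing_maps. (\<phi> f, \<phi> (f \<circ> g)) \<in> rel_compl A R))"

definition bqo_on :: "'a set \<Rightarrow> 'a rel \<Rightarrow> bool" where
  "bqo_on Q r \<longleftrightarrow> preorder_on Q r \<and> better_relation Q r"

definition g_bqo_on :: "(nat \<Rightarrow> nat) \<Rightarrow> 'a set \<Rightarrow> 'a rel \<Rightarrow> bool" where
  "g_bqo_on g Q r \<longleftrightarrow> preorder_on Q r \<and> g_better_relation g Q r"

end

theory Submission
  imports Defs
begin

text \<open>Enumerating infinite sets turns the deletion of the minimum into precomposition with \<^const>\<open>Suc\<close>,
  so better-relations are the \<open>Suc\<close>-better-relations. It therefore suffices to find continuous maps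
  \<open>\<rho>\<close> on the increasing maps that intertwine precomposition with \<open>g\<close> and with \<open>Suc\<close>. Let \<open>k\<close> be the
  least non-fixed point of \<open>g\<close> and \<open>h j = (g ^^ j) k\<close>. As \<open>g \<circ> h = h \<circ> Suc\<close>, the map \<open>\<rho> f = f \<circ> h\<close>
  satisfies \<open>\<rho> (f \<circ> g) = \<rho> f \<circ> Suc\<close>. Conversely, \<open>g\<close> fixes every \<open>n < k\<close> and maps the block
  \<open>{h j..<h (j + 1)}\<close> into the next one, so that moving the \<open>j\<close>-th block into the \<open>f j\<close>-th one
  by \<open>f j - j\<close> iterations of \<open>g\<close> defines an increasing \<open>\<rho> f\<close> with \<open>\<rho> (f \<circ> Suc) = \<rho> f \<circ> g\<close>.\<close>

section \<open>Continuity\<close>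

text \<open>A preimage contains, around each of its points, a neighbourhood on which
  \<open>F\<close> is constant, so it is open.\<close>

lemma continuous_map_discrete_if_locally_constant:
  assumes "\<And>x. x \<in> topspace X \<Longrightarrow> F x \<in> B"
    and "\<And>x. x \<in> topspace X \<Longrightarrow> \<exists>U. openin X U \<and> x \<in> U \<and> (\<forall>y\<in>U. F y = F x)"
  shows "continuous_map X (discrete_topology B) F"
  unfolding continuous_map_def
proof (intro conjI allI impI)
  show "F \<in> topspace X \<rightarrow> topspace (discrete_topology B)"
    using assms(1) by auto
  fix V
  show "openin X {x \<in> topspace X. F x \<in> V}"
  proof (subst openin_subopen, clarify)
    fix x assume x: "x \<in> topspace X" "F x \<in> V"
    then obtain U where "openin X U" "x \<in> U" "\<forall>y\<in>U. F y = F x"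
      using assms(2) by blast
    with x show "\<exists>T. openin X T \<and> x \<in> T \<and> T \<subseteq> {x \<in> topspace X. F x \<in> V}"
      using openin_subset by (intro exI[of _ U]) fastforce
  qed
qed

lemma topspace_increasing: "topspace increasing_topology = strict_increasing_maps"
  by (auto simp: increasing_topology_def)

lemma topspace_infinite_sets: "topspace infinite_sets_topology = infinite_sets"
  by (auto simp: infinite_sets_topology_def topspace_pullback_topology)

lemma continuous_map_increasing_component:
  "continuous_map increasing_topology (discrete_topology UNIV) (\<lambda>f. f n)"
  unfolding increasing_topology_def
  by (intro continuous_map_from_subtopology continuous_map_product_projection) auto

lemma continuous_map_infinite_sets_component:
  "continuous_map infinite_sets_topology (discrete_topology UNIV) (\<lambda>N. n \<in> N)"
proof -
  have "continuous_map infinite_sets_topology (discrete_topology UNIV)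
      ((\<lambda>c. c n) \<circ> (\<lambda>N m. m \<in> N))"
    unfolding infinite_sets_topology_def
    by (intro continuous_map_from_subtopology continuous_map_pullback
        continuous_map_product_projection) auto
  then show ?thesis
    by (simp add: o_def)
qed

lemma continuous_map_into_increasing:
  assumes "\<And>x. x \<in> topspace X \<Longrightarrow> F x \<in> strict_increasing_maps"
    and "\<And>n. continuous_map X (discrete_topology UNIV) (\<lambda>x. F x n)"
  shows "continuous_map X increasing_topology F"
  unfolding increasing_topology_def
  using assms by (auto simp: continuous_map_in_subtopology continuous_map_componentwise_UNIV)

lemma continuous_map_into_infinite_sets:
  assumes "\<And>x. x \<in> topspace X \<Longrightarrow> F x \<in> infinite_sets"
    and "\<And>n. continuous_map X (discrete_topology UNIV) (\<lambda>x. n \<in> F x)"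
  shows "continuous_map X infinite_sets_topology F"
proof -
  have "continuous_map X (product_topology (\<lambda>_. discrete_topology UNIV) UNIV)
      ((\<lambda>N n. n \<in> N) \<circ> F)"
    using assms(2) by (simp add: continuous_map_componentwise_UNIV o_def)
  then show ?thesis
    unfolding infinite_sets_topology_def
    using assms(1)
    by (auto simp: continuous_map_in_subtopology intro!: continuous_map_pullback')
qed

text \<open>A finite intersection of preimages of points. The coordinates \<open>c\<close> stay
  abstract to cover both values of maps and membership in sets.\<close>

lemma openin_cylinder:
  fixes n :: nat
  assumes "\<And>i. continuous_map X (discrete_topology UNIV) (\<lambda>y. c y i)"
  shows "openin X {y \<in> topspace X. \<forall>i\<le>n. c y i = c x i}"
proof -
  have "openin X {y \<in> topspace X. c y i \<in> {c x i}}" for i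
    by (rule openin_continuous_map_preimage[OF assms]) simp
  then have "openin X (\<Inter>i\<in>{..n}. {y \<in> topspace X. c y i \<in> {c x i}})"
    by (intro openin_INT2) auto
  also have "(\<Inter>i\<in>{..n}. {y \<in> topspace X. c y i \<in> {c x i}})
      = {y \<in> topspace X. \<forall>i\<le>n. c y i = c x i}"
    by auto
  finally show ?thesis .
qed

text \<open>Since \<open>m \<le> f m\<close>, only arguments up to \<open>n\<close> can reach
  \<open>n\<close>. Thus finitely many values of \<open>f\<close> decide whether \<open>n\<close> is
  in its range, which makes \<open>range\<close> continuous.\<close>

lemma mem_range_strict_mono_iff:
  fixes f :: "nat \<Rightarrow> nat"
  assumes "strict_mono f"
  shows "n \<in> range f \<longleftrightarrow> (\<exists>m\<le>n. f m = n)"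
  using strict_mono_imp_increasing[OF assms] by auto

lemma continuous_map_range:
  "continuous_map increasing_topology infinite_sets_topology range"
proof (rule continuous_map_into_infinite_sets)
  fix f :: "nat \<Rightarrow> nat" assume "f \<in> topspace increasing_topology"
  then show "range f \<in> infinite_sets"
    by (auto simp: topspace_increasing strict_increasing_maps_def infinite_sets_def
        range_inj_infinite strict_mono_imp_inj_on)
next
  fix n
  show "continuous_map increasing_topology (discrete_topology UNIV) (\<lambda>f. n \<in> range f)"
  proof (rule continuous_map_discrete_if_locally_constant)
    fix f :: "nat \<Rightarrow> nat" assume f: "f \<in> topspace increasing_topology"
    let ?U = "{f' \<in> topspace increasing_topology. \<forall>i\<le>n. f' i = f i}"
    have "openin increasing_topology ?U"
      by (rule openin_cylinder[OF continuous_map_increasing_component])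
    moreover have "(n \<in> range f') = (n \<in> range f)" if "f' \<in> ?U" for f'
    proof -
      have "strict_mono f" "strict_mono f'"
        using that f by (auto simp: topspace_increasing strict_increasing_maps_def)
      then show ?thesis
        using that by (simp add: mem_range_strict_mono_iff cong: conj_cong)
    qed
    ultimately show "\<exists>U. openin increasing_topology U \<and> f \<in> U \<and>
        (\<forall>f'\<in>U. (n \<in> range f') = (n \<in> range f))"
      using f by (intro exI[of _ ?U]) blast
  qed simp
qed

text \<open>Each element is the least member beyond its predecessor, so membership up to its own
  value determines it. This makes \<open>enumerate\<close> continuous.\<close>

lemma enumerate_cong_initial:
  fixes M N :: "nat set"
  assumes "infinite M" "infinite N" "\<forall>i\<le>enumerate N n. i \<in> M \<longleftrightarrow> i \<in> N"
  shows "enumerate M n = enumerate N n"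
  using assms
proof (induction n arbitrary: M N)
  case 0
  have "enumerate N 0 \<in> N"
    using 0 by (simp add: enumerate_in_set)
  moreover have "enumerate N 0 \<le> i" if "i \<in> M" for i
  proof (rule ccontr)
    assume "\<not> enumerate N 0 \<le> i"
    with 0 that have "i \<in> N" by auto
    with \<open>\<not> enumerate N 0 \<le> i\<close> show False
      by (simp add: enumerate_0 Least_le)
  qed
  ultimately show ?case
    using 0 unfolding enumerate_0[of M] by (intro Least_equality) auto
next
  case (Suc n)
  have "i \<le> enumerate N (Suc n)" if "i \<le> enumerate N n" for i
    using that enumerate_step[OF Suc.prems(2), of n] by simp
  with Suc.prems have eq: "enumerate M n = enumerate N n"
    by (intro Suc.IH) blast+
  have "enumerate N (Suc n) \<in> N" "enumerate N n < enumerate N (Suc n)"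
    using enumerate_in_set[OF Suc.prems(2)] enumerate_step[OF Suc.prems(2)] by blast+
  moreover have "enumerate N (Suc n) \<le> i" if "i \<in> M" "enumerate N n < i" for i
  proof (rule ccontr)
    assume less: "\<not> enumerate N (Suc n) \<le> i"
    with Suc.prems that have "i \<in> N" by auto
    with less that Suc.prems show False
      by (simp add: enumerate_Suc'' Least_le)
  qed
  ultimately have "(LEAST i. i \<in> M \<and> enumerate N n < i) = enumerate N (Suc n)"
    using Suc.prems by (intro Least_equality) auto
  then show ?case
    using Suc.prems by (simp add: enumerate_Suc''[of M] eq)
qed

lemma continuous_map_enumerate:
  "continuous_map infinite_sets_topology increasing_topology enumerate"
proof (rule continuous_map_into_increasing)
  fix N :: "nat set" assume "N \<in> topspace infinite_sets_topology"
  then show "enumerate N \<in> strict_increasing_maps"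
    by (simp add: topspace_infinite_sets infinite_sets_def strict_increasing_maps_def
        strict_mono_enumerate)
next
  fix n
  show "continuous_map infinite_sets_topology (discrete_topology UNIV) (\<lambda>N. enumerate N n)"
  proof (rule continuous_map_discrete_if_locally_constant)
    fix N :: "nat set" assume N: "N \<in> topspace infinite_sets_topology"
    let ?U = "{M \<in> topspace infinite_sets_topology. \<forall>i\<le>enumerate N n. (i \<in> M) = (i \<in> N)}"
    have "openin infinite_sets_topology ?U"
      by (rule openin_cylinder[OF continuous_map_infinite_sets_component])
    moreover have "enumerate M n = enumerate N n" if "M \<in> ?U" for M
    proof (rule enumerate_cong_initial)
      show "infinite M" "infinite N"
        using that N by (simp_all add: topspace_infinite_sets infinite_sets_def)
    qed (use that in simp)
    ultimately show "\<exists>U. openin infinite_sets_topology U \<and> N \<in> U \<and>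
        (\<forall>M\<in>U. enumerate M n = enumerate N n)"
      using N by (intro exI[of _ ?U]) blast
  qed simp
qed

section \<open>Better-relations as relations on increasing maps\<close>

lemma enumerate_shift: "enumerate (shift N) = enumerate N \<circ> Suc"
  by (auto simp: shift_def enumerate_Suc' enumerate_0)

lemma shift_range:
  assumes "strict_mono f"
  shows "shift (range f) = range (f \<circ> Suc)"
proof -
  have "(LEAST n. n \<in> range f) = f 0"
    using assms by (intro Least_equality) (auto simp: strict_mono_less_eq)
  moreover have "range f = insert (f 0) (range (f \<circ> Suc))"
    by (auto simp: image_iff) (metis not0_implies_Suc)
  moreover have "f 0 \<notin> range (f \<circ> Suc)"
    using assms by (auto simp: strict_mono_eq)
  ultimately show ?thesis
    by (simp add: shift_def)
qed

text \<open>Bad maps are pulled back along \<open>range\<close> in one direction and along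
  \<open>enumerate\<close> in the other; both turn \<open>shift\<close> and precomposition with
  \<open>Suc\<close> into each other.\<close>

lemma better_relation_iff_Suc: "better_relation A R \<longleftrightarrow> g_better_relation Suc A R"
proof -
  have "\<exists>\<psi>. continuous_map increasing_topology (discrete_topology A) \<psi> \<and>
      (\<forall>f\<in>strict_increasing_maps. (\<psi> f, \<psi> (f \<circ> Suc)) \<in> rel_compl A R)"
    if "continuous_map infinite_sets_topology (discrete_topology A) \<phi>"
      and "\<forall>N\<in>infinite_sets. (\<phi> N, \<phi> (shift N)) \<in> rel_compl A R" for \<phi>
  proof (intro exI conjI ballI)
    show "continuous_map increasing_topology (discrete_topology A) (\<phi> \<circ> range)"
      using continuous_map_range that(1) by (rule continuous_map_compose)
    fix f :: "nat \<Rightarrow> nat" assume "f \<in> strict_increasing_maps"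
    then have "range f \<in> infinite_sets" "shift (range f) = range (f \<circ> Suc)"
      using continuous_map_range shift_range
      by (auto simp: continuous_map_def topspace_increasing topspace_infinite_sets
          strict_increasing_maps_def)
    then show "((\<phi> \<circ> range) f, (\<phi> \<circ> range) (f \<circ> Suc)) \<in> rel_compl A R"
      using that(2) by (metis comp_apply)
  qed
  moreover have "\<exists>\<phi>. continuous_map infinite_sets_topology (discrete_topology A) \<phi> \<and>
      (\<forall>N\<in>infinite_sets. (\<phi> N, \<phi> (shift N)) \<in> rel_compl A R)"
    if "continuous_map increasing_topology (discrete_topology A) \<psi>"
      and "\<forall>f\<in>strict_increasing_maps. (\<psi> f, \<psi> (f \<circ> Suc)) \<in> rel_compl A R" for \<psi>
  proof (intro exI conjI ballI)
    show "continuous_map infinite_sets_topology (discrete_topology A) (\<psi> \<circ> enumerate)"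
      using continuous_map_enumerate that(1) by (rule continuous_map_compose)
    fix N :: "nat set" assume "N \<in> infinite_sets"
    then have "enumerate N \<in> strict_increasing_maps"
      by (simp add: infinite_sets_def strict_increasing_maps_def strict_mono_enumerate)
    then show "((\<psi> \<circ> enumerate) N, (\<psi> \<circ> enumerate) (shift N)) \<in> rel_compl A R"
      using that(2) by (simp add: enumerate_shift)
  qed
  ultimately show ?thesis
    unfolding better_relation_def g_better_relation_def by blast
qed

text \<open>A bad map \<open>\<phi>\<close> for \<open>g'\<close> would pull back to the bad map
  \<open>\<phi> \<circ> \<rho>\<close> for \<open>g\<close>.\<close>

lemma g_better_relation_transfer:
  assumes "continuous_map increasing_topology increasing_topology \<rho>"
    and "g_better_relation g A R"
    and "\<And>f. f \<in> strict_increasing_maps \<Longrightarrow> \<rho> (f \<circ> g) = \<rho> f \<circ> g'"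
  shows "g_better_relation g' A R"
  unfolding g_better_relation_def
proof clarify
  fix \<phi>
  assume \<phi>: "continuous_map increasing_topology (discrete_topology A) \<phi>"
    "\<forall>f\<in>strict_increasing_maps. (\<phi> f, \<phi> (f \<circ> g')) \<in> rel_compl A R"
  have "continuous_map increasing_topology (discrete_topology A) (\<phi> \<circ> \<rho>)"
    using assms(1) \<phi>(1) by (rule continuous_map_compose)
  moreover have "((\<phi> \<circ> \<rho>) f, (\<phi> \<circ> \<rho>) (f \<circ> g)) \<in> rel_compl A R"
    if "f \<in> strict_increasing_maps" for f
    using that \<phi>(2) assms(1,3) by (auto simp: continuous_map_def topspace_increasing Pi_iff)
  ultimately show False
    using assms(2) by (auto simp: g_better_relation_def)
qed

section \<open>Intertwining \<open>g\<close> and the successor\<close>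

locale nontrivial_increasing =
  fixes g :: "nat \<Rightarrow> nat"
  assumes mono: "strict_mono g" and nontrivial: "g \<noteq> id"
begin

definition "k = (LEAST n. g n \<noteq> n)"

definition "h j = (g ^^ j) k"

text \<open>For \<open>k \<le> n\<close> this is the index of the interval
  \<open>{h j..<h (Suc j)}\<close> containing \<open>n\<close>. Testing only the upper end gives an
  index to the points below \<open>k\<close> as well.\<close>

definition "block n = (LEAST j. n < h (Suc j))"

text \<open>Since \<open>g\<close> fixes all \<open>n < k\<close> (which have \<open>block n = 0\<close>), so does \<open>spread f\<close>.\<close>
definition "spread f n = (g ^^ (f (block n) - block n)) n"

section \<open>The orbit of the least non-fixed point and its blocks\<close>

lemma fixed: "n < k \<Longrightarrow> g n = n"
  unfolding k_def using not_less_Least by blast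

lemma iterate_fixed: "n < k \<Longrightarrow> (g ^^ j) n = n"
  by (induction j) (auto simp: fixed)

lemma strict_mono_iterate: "strict_mono (g ^^ j)"
  by (induction j) (auto simp: strict_mono_def strict_monoD[OF mono])

lemma k_less: "k < g k"
proof -
  have "g k \<noteq> k"
    unfolding k_def using nontrivial by - (rule LeastI_ex, auto simp: fun_eq_iff)
  then show ?thesis
    using strict_mono_imp_increasing[OF mono, of k] by linarith
qed

lemma h_Suc: "h (Suc j) = g (h j)"
  by (simp add: h_def)

lemma iterate_h: "(g ^^ i) (h j) = h (i + j)"
  by (simp add: h_def funpow_add)

lemma strict_mono_h: "strict_mono h"
  unfolding strict_mono_Suc_iff
proof
  fix j
  show "h j < h (Suc j)"
    by (induction j) (simp_all add: h_def k_less strict_mono_less[OF mono])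
qed

lemma less_h_block: "n < h (Suc (block n))"
  unfolding block_def
proof (rule LeastI)
  \<comment> \<open>The index \<open>n\<close> itself passes the test, because
    \<open>Suc n \<le> h (Suc n)\<close>.\<close>
  show "n < h (Suc n)"
    using strict_mono_imp_increasing[OF strict_mono_h, of "Suc n"] by simp
qed

text \<open>By minimality the preceding index fails the test. At index 0 the bound would read
  \<open>k \<le> n\<close>, which is false for the points below \<open>k\<close>.\<close>

lemma h_block_le: "h (block n) \<le> n" if "block n > 0"
proof -
  have "\<not> n < h (Suc (block n - 1))"
    using that unfolding block_def by (intro not_less_Least) simp
  with that show ?thesis by simp
qed

lemma block_unique: "block n = j" if "h j \<le> n" "n < h (Suc j)"
  unfolding block_def
proof (rule Least_equality)
  show "n < h (Suc j)" by (rule that(2))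
  fix i assume "n < h (Suc i)"
  with that(1) have "h j < h (Suc i)" by simp
  then show "j \<le> i"
    by (simp add: strict_mono_less[OF strict_mono_h] less_Suc_eq_le)
qed

text \<open>Applying \<open>g\<close> to \<open>h j \<le> n < h (Suc j)\<close> shifts both ends by
  one index.\<close>

lemma block_g: "block (g n) = Suc (block n)" if "k \<le> n"
proof (rule block_unique)
  have "h (block n) \<le> n"
    using h_block_le[of n] that by (cases "block n") (auto simp: h_def)
  then show "h (Suc (block n)) \<le> g n"
    by (simp add: h_Suc strict_mono_less_eq[OF mono])
  show "g n < h (Suc (Suc (block n)))"
    using less_h_block[of n] by (simp only: h_Suc strict_mono_less[OF mono])
qed

lemma mono_block: "block m \<le> block n" if "m \<le> n"
proof -
  have "m < h (Suc (block n))"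
    using that less_h_block[of n] by simp
  then show ?thesis
    unfolding block_def[of m] by (rule Least_le)
qed

text \<open>Inside one block \<open>spread f\<close> is a single iterate of \<open>g\<close>. For
  blocks \<open>i < j\<close>, the image of the first lies below \<open>h (Suc (f i))\<close>, and
  that of the second starts no earlier than \<open>h (f j)\<close>.\<close>

lemma strict_mono_spread:
  assumes "strict_mono f"
  shows "strict_mono (spread f)"
  unfolding strict_mono_Suc_iff
proof
  fix n
  let ?i = "block n" and ?j = "block (Suc n)"
  \<comment> \<open>This makes the truncated subtraction in the exponent of \<open>spread\<close>
    exact.\<close>
  have le: "m \<le> f m" for m
    using strict_mono_imp_increasing[OF assms] .
  show "spread f n < spread f (Suc n)"
  proof (cases "?i = ?j")
    case True
    then show ?thesis
      by (simp add: spread_def strict_mono_less[OF strict_mono_iterate])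
  next
    case False
    then have ij: "?i < ?j"
      using mono_block[of n "Suc n"] by simp
    have "spread f n < (g ^^ (f ?i - ?i)) (h (Suc ?i))"
      unfolding spread_def strict_mono_less[OF strict_mono_iterate] by (rule less_h_block)
    also have "\<dots> = h (Suc (f ?i))"
      using le[of ?i] by (simp add: iterate_h)
    also have "\<dots> \<le> h (f ?j)"
      using strict_monoD[OF assms ij] by (simp add: strict_mono_less_eq[OF strict_mono_h] Suc_leI)
    also have "\<dots> = (g ^^ (f ?j - ?j)) (h ?j)"
      using le[of ?j] by (simp add: iterate_h)
    also have "\<dots> \<le> spread f (Suc n)"
      unfolding spread_def strict_mono_less_eq[OF strict_mono_iterate]
      \<comment> \<open>The later block has positive index, so its lower bound is available.\<close>
      using ij by (intro h_block_le) simp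
    finally show ?thesis .
  qed
qed

text \<open>Both sides fix the points below \<open>k\<close>. Elsewhere \<open>g\<close> raises the
  block index by one, so the exponent on the right is one smaller, and the inner \<open>g\<close>
  supplies the missing iteration.\<close>

lemma spread_comp_Suc:
  assumes "strict_mono f"
  shows "spread (f \<circ> Suc) = spread f \<circ> g"
proof
  fix n
  show "spread (f \<circ> Suc) n = (spread f \<circ> g) n"
  proof (cases "n < k")
    case True
    then show ?thesis
      by (simp add: spread_def iterate_fixed fixed)
  next
    case False
    let ?j = "block n"
    have "Suc ?j \<le> f (Suc ?j)"
      using strict_mono_imp_increasing[OF assms] .
    then have "f (Suc ?j) - ?j = Suc (f (Suc ?j) - Suc ?j)"
      by simp
    then have "(g ^^ (f (Suc ?j) - ?j)) n = (g ^^ (f (Suc ?j) - Suc ?j)) (g n)"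
      by (simp only: funpow_Suc_right comp_apply)
    then show ?thesis
      using False by (simp add: spread_def block_g)
  qed
qed

section \<open>Continuity: each output coordinate depends on one value of \<open>f\<close>\<close>

lemma continuous_map_spread: "continuous_map increasing_topology increasing_topology spread"
proof (rule continuous_map_into_increasing)
  fix n
  have "continuous_map increasing_topology (discrete_topology UNIV)
      ((\<lambda>m. (g ^^ (m - block n)) n) \<circ> (\<lambda>f. f (block n)))"
    by (rule continuous_map_compose[OF continuous_map_increasing_component]) simp
  then show "continuous_map increasing_topology (discrete_topology UNIV) (\<lambda>f. spread f n)"
    by (simp add: spread_def o_def)
qed (simp add: topspace_increasing strict_increasing_maps_def strict_mono_spread)

lemma continuous_map_comp_h:
  "continuous_map increasing_topology increasing_topology (\<lambda>f. f \<circ> h)"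
proof (rule continuous_map_into_increasing)
  show "continuous_map increasing_topology (discrete_topology UNIV) (\<lambda>f. (f \<circ> h) n)" for n
    by (simp add: continuous_map_increasing_component)
qed (simp add: topspace_increasing strict_increasing_maps_def strict_mono_o strict_mono_h)

lemma g_better_relation_iff: "g_better_relation g A R \<longleftrightarrow> better_relation A R"
  unfolding better_relation_iff_Suc
proof
  assume "g_better_relation g A R"
  with continuous_map_comp_h show "g_better_relation Suc A R"
    by (rule g_better_relation_transfer) (auto simp: h_Suc)
next
  assume "g_better_relation Suc A R"
  with continuous_map_spread show "g_better_relation g A R"
    by (rule g_better_relation_transfer) (simp add: strict_increasing_maps_def spread_comp_Suc)
qed

end

theorem theorem4p11:
  fixes g :: "nat \<Rightarrow> nat"
    and A :: "'a set" and R :: "'a rel"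
    and Q :: "'b set" and le :: "'b rel"
  assumes "g \<in> strict_increasing_maps" and "g \<noteq> id"
  shows "(R \<subseteq> A \<times> A \<longrightarrow> (g_better_relation g A R \<longleftrightarrow> better_relation A R)) \<and>
         (preorder_on Q le \<longrightarrow> (g_bqo_on g Q le \<longleftrightarrow> bqo_on Q le))"
proof -
  interpret nontrivial_increasing g
    using assms by unfold_locales (simp_all add: strict_increasing_maps_def)
  show ?thesis
    \<comment> \<open>Both bqo notions carry the same preorder clause, so the second claim is the
      equivalence at \<open>Q\<close> and \<open>le\<close>.\<close>
    by (simp add: g_better_relation_iff g_bqo_on_def bqo_on_def)
qed

end
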